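(* Let $A\subseteq E$ be associative conformal algebras ($A$ a subalgebra of $E$), and let $Q$ be a complement of $A$ in $E$, with associated matched pair of associative conformal algebras $(A,Q,\lhd_\lambda,\rhd_\lambda,\leftharpoonup_\lambda,\rightharpoonup_\lambda)$. Then $\equiv$ is an equivalence relation on the set $\mathcal{DM}(Q,A\mid(\lhd_\lambda,\rhd_\lambda,\leftharpoonup_\lambda,\rightharpoonup_\lambda))$ of deformation maps, and the map $$\mathcal{HA}^2(Q,A\mid(\lhd_\lambda,\rhd_\lambda,\leftharpoonup_\lambda,\rightharpoonup_\lambda)):=\mathcal{DM}(Q,A\mid(\lhd_\lambda,\rhd_\lambda,\leftharpoonup_\lambda,\rightharpoonup_\lambda))/\equiv\ \longrightarrow\ \mathcal{F}(A,E),\qquad \overline{\varphi}\mapsto Q_\varphi,$$ sending the class $\overline{\varphi}$ of $\varphi$ to the isomorphism class of complements of $A$ in $E$ that are isomorphic to $Q_\varphi$, is a bijection between $\mathcal{HA}^2(Q,A\mid(\lhd_\lambda,\rhd_\lambda,\leftharpoonup_\lambda,\rightharpoonup_\lambda))$ and the set $\mathcal{F}(A,E)$ of isomorphism classes of complements of $A$ in $E$.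
   Context: All vector spaces are over $\mathbb{C}$. An associative conformal algebra is a $\mathbb{C}[\partial]$-module $A$ with a $\mathbb{C}$-bilinear map $A\times A\to A[\lambda]$, $(a,b)\mapsto a_\lambda b$, satisfying $(\partial a)_\lambda b=-\lambda a_\lambda b$, $a_\lambda(\partial b)=(\partial+\lambda)a_\lambda b$ and $(a_\lambda b)_{\lambda+\mu}c=a_\lambda(b_\mu c)$ for all $a,b,c\in A$. $\mathbb{C}[\partial]$-module maps are extended coefficientwise to polynomials in $\lambda$. Homomorphisms are $\mathbb{C}[\partial]$-module maps preserving $\lambda$-products. A complement of a subalgebra $A$ in $E$ is a subalgebra $Q$ of $E$ such that $E=A\oplus Q$ as $\mathbb{C}[\partial]$-modules. $\mathcal{F}(A,E)$ denotes the set of isomorphism classes (as associative conformal algebras) of complements of $A$ in $E$. Elements of $E=A\oplus Q$ are written $a\oplus x$ with $a\in A$, $x\in Q$. The associated matched pair $(A,Q,\lhd_\lambda,\rhd_\lambda,\leftharpoonup_\lambda,\rightharpoonup_\lambda)$ consists of the operations $\rhd_\lambda:Q\times A\to A[\lambda]$, $\lhd_\lambda:Q\times A\to Q[\lambda]$, $\leftharpoonup_\lambda:A\times Q\to A[\lambda]$, $\rightharpoonup_\lambda:A\times Q\to Q[\lambda]$ determined by $x_\lambda a=(x\rhd_\lambda a)\oplus(x\lhd_\lambda a)$ and $a_\lambda x=(a\leftharpoonup_\lambda x)\oplus(a\rightharpoonup_\lambda x)$ for $a\in A$, $x\in Q$. The $\lambda$-product of $E$ is then that of the bicrossed product of $A$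 and $Q$: $$(a\oplus x)_\lambda(b\oplus y)=(a_\lambda b+a\leftharpoonup_\lambda y+x\rhd_\lambda b)\oplus(a\rightharpoonup_\lambda y+x\lhd_\lambda b+x_\lambda y).$$ A deformation map of the matched pair is a $\mathbb{C}[\partial]$-module homomorphism $\varphi:Q\to A$ such that for all $x,y\in Q$ $$\varphi(x_\lambda y)-\varphi(x)_\lambda\varphi(y)=\varphi(x)\leftharpoonup_\lambda y+x\rhd_\lambda\varphi(y)-\varphi(\varphi(x)\rightharpoonup_\lambda y)-\varphi(x\lhd_\lambda\varphi(y)).$$ The set of all deformation maps is $\mathcal{DM}(Q,A\mid(\lhd_\lambda,\rhd_\lambda,\leftharpoonup_\lambda,\rightharpoonup_\lambda))$. For a deformation map $\varphi$, the $\varphi$-deformation $Q_\varphi$ of $Q$ is the $\mathbb{C}[\partial]$-module $Q$ with the $\lambda$-product $(x_\lambda y)_\varphi:=x_\lambda y+x\lhd_\lambda\varphi(y)+\varphi(x)\rightharpoonup_\lambda y$, which is an associative conformal algebra isomorphic to the complement $\{\varphi(x)\oplus x: x\in Q\}$ of $A$ in $E$. Two deformation maps $\varphi,\phi:Q\to A$ are equivalent, written $\varphi\equiv\phi$, if there is a $\mathbb{C}[\partial]$-module isomorphism $\alpha:Q\to Q$ such that for all $x,y\in Q$ $$\alpha(x_\lambda y)-\alpha(x)_\lambda\alpha(y)=\alpha(x)\lhd_\lambda\phi(\alpha(y))-\alpha(x\lhd_\lambda\varphi(y))+\phi(\alpha(x))\rightharpoonup_\lambda\alpha(y)-\alpha(\varphi(x)\rightharpoonup_\lambda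 y).$$ *)

theory Defs
  imports
    Complex_Main
    "HOL-Computational_Algebra.Polynomial"
    "HOL-Library.FuncSet"
begin

text \<open>
  A \<open>\<complex>[\<partial>]\<close>-module is a library \<^locale>\<open>module\<close> over the ring \<^typ>\<open>complex poly\<close>, whose
  indeterminate is \<open>\<partial>\<close>; complex scalars are the constant polynomials.  Algebras live on
  \<open>\<complex>[\<partial>]\<close>-submodules (carrier sets) of an ambient module.  A \<open>\<lambda>\<close>-product takes values in
  \<open>'e poly\<close>, where the indeterminate is \<open>\<lambda>\<close>; so \<open>pCons 0\<close> is multiplication by \<open>\<lambda>\<close>, and
  \<^const>\<open>map_poly\<close> is the coefficientwise extension of a map.
\<close>

abbreviation deriv_op :: "(complex poly \<Rightarrow> 'e \<Rightarrow> 'e) \<Rightarrow> 'e \<Rightarrow> 'e::ab_group_add"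
  where "deriv_op scl \<equiv> scl [:0, 1:]"

abbreviation cscale :: "(complex poly \<Rightarrow> 'e \<Rightarrow> 'e) \<Rightarrow> complex \<Rightarrow> 'e \<Rightarrow> 'e::ab_group_add"
  where "cscale scl c \<equiv> scl [:c:]"

definition polys_over :: "'e::zero set \<Rightarrow> 'e poly set"
  where "polys_over V = {p. \<forall>n. coeff p n \<in> V}"

text \<open>
  Polynomials in \<open>\<lambda>\<close> and \<open>\<mu>\<close> are elements of \<open>'e poly poly\<close> with outer variable \<open>\<mu>\<close> and inner
  variable \<open>\<lambda>\<close>.  Multiplication by \<open>\<mu>\<close> is \<open>pCons 0\<close>, multiplication by \<open>\<lambda>\<close> is the following.
\<close>

definition lam_mult :: "'e::zero poly poly \<Rightarrow> 'e poly poly"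
  where "lam_mult = map_poly (pCons 0)"

text \<open>Substitution of \<open>\<lambda> + \<mu>\<close> for the variable of a polynomial, by Horner's scheme.\<close>

definition subst_sum :: "'e::ab_group_add poly \<Rightarrow> 'e poly poly"
  where "subst_sum p = fold_coeffs (\<lambda>d q. [:[:d:]:] + (lam_mult q + pCons 0 q)) p 0"

text \<open>
  If \<open>p = \<Sum>i. \<lambda>^i d_i\<close>, then \<open>prod_at_sum lp p c\<close> is \<open>p_{\<lambda>+\<mu>} c = \<Sum>i. \<lambda>^i ((d_i)_{\<lambda>+\<mu>} c)\<close>.
\<close>

definition prod_at_sum ::
    "('e \<Rightarrow> 'e \<Rightarrow> 'e poly) \<Rightarrow> 'e::ab_group_add poly \<Rightarrow> 'e \<Rightarrow> 'e poly poly"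
  where "prod_at_sum lp p c = (\<Sum>i\<le>degree p. (lam_mult ^^ i) (subst_sum (lp (coeff p i) c)))"

locale assoc_conformal_algebra = module scl
  for scl :: "complex poly \<Rightarrow> 'e::ab_group_add \<Rightarrow> 'e" +
  fixes V :: "'e set"
    and lp :: "'e \<Rightarrow> 'e \<Rightarrow> 'e poly"
  assumes carrier: "subspace V"
    and closed: "\<lbrakk>a \<in> V; b \<in> V\<rbrakk> \<Longrightarrow> lp a b \<in> polys_over V"
    and add_left: "\<lbrakk>a \<in> V; a' \<in> V; b \<in> V\<rbrakk> \<Longrightarrow> lp (a + a') b = lp a b + lp a' b"
    and add_right: "\<lbrakk>a \<in> V; b \<in> V; b' \<in> V\<rbrakk> \<Longrightarrow> lp a (b + b') = lp a b + lp a b'"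
    and scale_left: "\<lbrakk>a \<in> V; b \<in> V\<rbrakk> \<Longrightarrow> lp (cscale scl k a) b = map_poly (cscale scl k) (lp a b)"
    and scale_right: "\<lbrakk>a \<in> V; b \<in> V\<rbrakk> \<Longrightarrow> lp a (cscale scl k b) = map_poly (cscale scl k) (lp a b)"
    and deriv_left: "\<lbrakk>a \<in> V; b \<in> V\<rbrakk> \<Longrightarrow> lp (deriv_op scl a) b = - pCons 0 (lp a b)"
    and deriv_right:
      "\<lbrakk>a \<in> V; b \<in> V\<rbrakk> \<Longrightarrow> lp a (deriv_op scl b) = map_poly (deriv_op scl) (lp a b) + pCons 0 (lp a b)"
    and assoc: "\<lbrakk>a \<in> V; b \<in> V; c \<in> V\<rbrakk> \<Longrightarrow> prod_at_sum lp (lp a b) c = map_poly (lp a) (lp b c)"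

definition subalgebra ::
    "(complex poly \<Rightarrow> 'e \<Rightarrow> 'e) \<Rightarrow> 'e set \<Rightarrow> ('e \<Rightarrow> 'e \<Rightarrow> 'e poly) \<Rightarrow> 'e::ab_group_add set \<Rightarrow> bool"
  where "subalgebra scl E lp A \<longleftrightarrow>
    A \<subseteq> E \<and> module.subspace scl A \<and> (\<forall>a\<in>A. \<forall>b\<in>A. lp a b \<in> polys_over A)"

definition complements ::
    "(complex poly \<Rightarrow> 'e \<Rightarrow> 'e) \<Rightarrow> 'e set \<Rightarrow> ('e \<Rightarrow> 'e \<Rightarrow> 'e poly) \<Rightarrow> 'e::ab_group_add set \<Rightarrow> 'e set set"
  where "complements scl E lp A =
    {Q. subalgebra scl E lp Q \<and> A \<inter> Q = {0} \<and> E = {a + x | a x. a \<in> A \<and> x \<in> Q}}"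

definition module_map_on ::
    "(complex poly \<Rightarrow> 'e \<Rightarrow> 'e) \<Rightarrow> 'e set \<Rightarrow> 'e set \<Rightarrow> ('e::ab_group_add \<Rightarrow> 'e) \<Rightarrow> bool"
  where "module_map_on scl V W f \<longleftrightarrow>
    f \<in> V \<rightarrow> W \<and> (\<forall>x\<in>V. \<forall>y\<in>V. f (x + y) = f x + f y) \<and> (\<forall>p. \<forall>x\<in>V. f (scl p x) = scl p (f x))"

definition conformal_hom ::
    "(complex poly \<Rightarrow> 'e \<Rightarrow> 'e) \<Rightarrow> 'e set \<Rightarrow> ('e \<Rightarrow> 'e \<Rightarrow> 'e poly) \<Rightarrow>
      'e set \<Rightarrow> ('e \<Rightarrow> 'e \<Rightarrow> 'e poly) \<Rightarrow> ('e::ab_group_add \<Rightarrow> 'e) \<Rightarrow> bool"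
  where "conformal_hom scl V lpV W lpW f \<longleftrightarrow>
    module_map_on scl V W f \<and> (\<forall>x\<in>V. \<forall>y\<in>V. map_poly f (lpV x y) = lpW (f x) (f y))"

definition conformal_isomorphic ::
    "(complex poly \<Rightarrow> 'e \<Rightarrow> 'e) \<Rightarrow> 'e set \<Rightarrow> ('e \<Rightarrow> 'e \<Rightarrow> 'e poly) \<Rightarrow>
      'e set \<Rightarrow> ('e \<Rightarrow> 'e \<Rightarrow> 'e::ab_group_add poly) \<Rightarrow> bool"
  where "conformal_isomorphic scl V lpV W lpW \<longleftrightarrow>
    (\<exists>f. conformal_hom scl V lpV W lpW f \<and> bij_betw f V W)"

definition complement_iso ::
    "(complex poly \<Rightarrow> 'e \<Rightarrow> 'e) \<Rightarrow> 'e set \<Rightarrow> ('e \<Rightarrow> 'e \<Rightarrow> 'e poly) \<Rightarrow> 'e::ab_group_add set \<Rightarrow>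
      ('e set \<times> 'e set) set"
  where "complement_iso scl E lp A =
    {(C, C'). C \<in> complements scl E lp A \<and> C' \<in> complements scl E lp A \<and>
      conformal_isomorphic scl C lp C' lp}"

definition complement_classes ::
    "(complex poly \<Rightarrow> 'e \<Rightarrow> 'e) \<Rightarrow> 'e set \<Rightarrow> ('e \<Rightarrow> 'e \<Rightarrow> 'e poly) \<Rightarrow> 'e::ab_group_add set \<Rightarrow>
      'e set set set"
  where "complement_classes scl E lp A = complements scl E lp A // complement_iso scl E lp A"

text \<open>
  The actions of a matched pair are written \<open>lhd\<close> (\<open>x \<lhd> a\<close>), \<open>rhd\<close> (\<open>x \<rhd> a\<close>), \<open>lhp\<close>
  (\<open>a \<leftharpoonup> x\<close>) and \<open>rhp\<close> (\<open>a \<rightharpoonup> x\<close>).  When \<open>A\<close> and \<open>Q\<close> are complementary, the following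
  determines them uniquely on \<open>Q \<times> A\<close> and \<open>A \<times> Q\<close> respectively; their values elsewhere are
  never used.
\<close>

definition associated_matched_pair ::
    "('e \<Rightarrow> 'e \<Rightarrow> 'e poly) \<Rightarrow> 'e set \<Rightarrow> 'e set \<Rightarrow>
      ('e \<Rightarrow> 'e \<Rightarrow> 'e poly) \<Rightarrow> ('e \<Rightarrow> 'e \<Rightarrow> 'e poly) \<Rightarrow>
      ('e \<Rightarrow> 'e \<Rightarrow> 'e poly) \<Rightarrow> ('e \<Rightarrow> 'e \<Rightarrow> 'e::ab_group_add poly) \<Rightarrow> bool"
  where "associated_matched_pair lp A Q lhd rhd lhp rhp \<longleftrightarrow>
    (\<forall>x\<in>Q. \<forall>a\<in>A. rhd x a \<in> polys_over A \<and> lhd x a \<in> polys_over Q \<and> lp x a = rhd x a + lhd x a) \<and>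
    (\<forall>a\<in>A. \<forall>x\<in>Q. lhp a x \<in> polys_over A \<and> rhp a x \<in> polys_over Q \<and> lp a x = lhp a x + rhp a x)"

text \<open>
  Maps on \<open>Q\<close> are represented by the total functions that are \<^const>\<open>undefined\<close> outside \<open>Q\<close>, so
  that each deformation map is counted once.
\<close>

definition deformation_maps ::
    "(complex poly \<Rightarrow> 'e \<Rightarrow> 'e) \<Rightarrow> ('e \<Rightarrow> 'e \<Rightarrow> 'e poly) \<Rightarrow> 'e set \<Rightarrow> 'e set \<Rightarrow>
      ('e \<Rightarrow> 'e \<Rightarrow> 'e poly) \<Rightarrow> ('e \<Rightarrow> 'e \<Rightarrow> 'e poly) \<Rightarrow>
      ('e \<Rightarrow> 'e \<Rightarrow> 'e poly) \<Rightarrow> ('e \<Rightarrow> 'e \<Rightarrow> 'e poly) \<Rightarrow> ('e::ab_group_add \<Rightarrow> 'e) set"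
  where "deformation_maps scl lp Q A lhd rhd lhp rhp =
    {\<phi> \<in> extensional Q. module_map_on scl Q A \<phi> \<and>
      (\<forall>x\<in>Q. \<forall>y\<in>Q.
        map_poly \<phi> (lp x y) - lp (\<phi> x) (\<phi> y) =
        lhp (\<phi> x) y + rhd x (\<phi> y) - map_poly \<phi> (rhp (\<phi> x) y) - map_poly \<phi> (lhd x (\<phi> y)))}"

definition deformed_product ::
    "('e \<Rightarrow> 'e \<Rightarrow> 'e poly) \<Rightarrow> ('e \<Rightarrow> 'e \<Rightarrow> 'e poly) \<Rightarrow> ('e \<Rightarrow> 'e \<Rightarrow> 'e poly) \<Rightarrow>
      ('e::ab_group_add \<Rightarrow> 'e) \<Rightarrow> 'e \<Rightarrow> 'e \<Rightarrow> 'e poly"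
  where "deformed_product lp lhd rhp \<phi> x y = lp x y + lhd x (\<phi> y) + rhp (\<phi> x) y"

definition deformation_equiv ::
    "(complex poly \<Rightarrow> 'e \<Rightarrow> 'e) \<Rightarrow> ('e \<Rightarrow> 'e \<Rightarrow> 'e poly) \<Rightarrow> 'e set \<Rightarrow> 'e set \<Rightarrow>
      ('e \<Rightarrow> 'e \<Rightarrow> 'e poly) \<Rightarrow> ('e \<Rightarrow> 'e \<Rightarrow> 'e poly) \<Rightarrow>
      ('e \<Rightarrow> 'e \<Rightarrow> 'e poly) \<Rightarrow> ('e \<Rightarrow> 'e \<Rightarrow> 'e poly) \<Rightarrow>
      (('e::ab_group_add \<Rightarrow> 'e) \<times> ('e \<Rightarrow> 'e)) set"
  where "deformation_equiv scl lp Q A lhd rhd lhp rhp =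
    {(\<phi>, \<psi>). \<phi> \<in> deformation_maps scl lp Q A lhd rhd lhp rhp \<and>
      \<psi> \<in> deformation_maps scl lp Q A lhd rhd lhp rhp \<and>
      (\<exists>\<alpha>. module_map_on scl Q Q \<alpha> \<and> bij_betw \<alpha> Q Q \<and>
        (\<forall>x\<in>Q. \<forall>y\<in>Q.
          map_poly \<alpha> (lp x y) - lp (\<alpha> x) (\<alpha> y) =
          lhd (\<alpha> x) (\<psi> (\<alpha> y)) - map_poly \<alpha> (lhd x (\<phi> y)) +
          rhp (\<psi> (\<alpha> x)) (\<alpha> y) - map_poly \<alpha> (rhp (\<phi> x) y)))}"

definition HA2 ::
    "(complex poly \<Rightarrow> 'e \<Rightarrow> 'e) \<Rightarrow> ('e \<Rightarrow> 'e \<Rightarrow> 'e poly) \<Rightarrow> 'e set \<Rightarrow> 'e set \<Rightarrow>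
      ('e \<Rightarrow> 'e \<Rightarrow> 'e poly) \<Rightarrow> ('e \<Rightarrow> 'e \<Rightarrow> 'e poly) \<Rightarrow>
      ('e \<Rightarrow> 'e \<Rightarrow> 'e poly) \<Rightarrow> ('e \<Rightarrow> 'e \<Rightarrow> 'e poly) \<Rightarrow> ('e::ab_group_add \<Rightarrow> 'e) set set"
  where "HA2 scl lp Q A lhd rhd lhp rhp =
    deformation_maps scl lp Q A lhd rhd lhp rhp // deformation_equiv scl lp Q A lhd rhd lhp rhp"

end

theory Submission
  imports Defs
begin

text \<open>
  A complement \<open>C\<close> of \<open>A\<close> meets every coset \<open>A + x\<close> with \<open>x \<in> Q\<close> in exactly one point, because
  both \<open>C\<close> and \<open>Q\<close> represent \<open>E/A\<close>.  Hence \<open>C\<close> is the graph \<open>{\<phi> x + x | x. x \<in> Q}\<close> of a unique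
  \<open>\<complex>[\<partial>]\<close>-linear map \<open>\<phi>: Q \<rightarrow> A\<close>.  The \<open>\<lambda>\<close>-product of two points of a graph splits as
  \<open>(\<phi> x + x)_\<lambda> (\<phi> y + y) =
    (\<phi>(x)_\<lambda> \<phi>(y) + \<phi> x \<leftharpoonup> y + x \<rhd> \<phi> y) \<oplus> (x_\<lambda> y + x \<lhd> \<phi> y + \<phi> x \<rightharpoonup> y)\<close>,
  whose \<open>Q\<close>-part is the product of \<open>Q\<^sub>\<phi>\<close>.  So the graph is closed under the product precisely
  when \<open>\<phi>\<close> maps the second summand to the first, and this is the deformation equation
  (\<open>deformation_maps_iff\<close>).  Therefore the complements are the graphs of the deformation maps
  (\<open>graph_is_complement\<close>, \<open>complement_is_graph\<close>), and \<open>x \<mapsto> \<phi> x + x\<close> is an isomorphism from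
  \<open>Q\<^sub>\<phi>\<close> to the graph of \<open>\<phi>\<close> (\<open>deformed_iso_graph\<close>).

  In the same way, the equation that defines \<open>\<phi> \<equiv> \<psi>\<close>, with its terms moved across, says that
  \<open>\<alpha>\<close> is an isomorphism \<open>Q\<^sub>\<phi> \<rightarrow> Q\<^sub>\<psi>\<close> (\<open>deformation_equiv_iff\<close>).  So \<open>\<equiv>\<close> is an equivalence
  relation because being isomorphic is one, two deformation maps have the same isomorphism class of
  complements exactly when they are equivalent, and every class is reached because every complement
  is a graph.
\<close>

section \<open>Polynomials over a submodule and isomorphisms of \<open>\<lambda>\<close>-products\<close>

locale differential_module = module scl
  for scl :: "complex poly \<Rightarrow> 'e::ab_group_add \<Rightarrow> 'e"
begin

lemma polys_over_add:
  assumes "subspace V" "p \<in> polys_over V" "q \<in> polys_over V"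
  shows "p + q \<in> polys_over V"
  using assms by (auto simp: polys_over_def subspace_add)

lemma module_map_on_0:
  assumes "subspace V" "module_map_on scl V W f"
  shows "f 0 = 0"
proof -
  have "f (0 + 0) = f 0 + f 0"
    using assms subspace_0 unfolding module_map_on_def by blast
  then show ?thesis by simp
qed

lemma coeff_map_poly_module_map:
  assumes "subspace V" "module_map_on scl V W f"
  shows "coeff (map_poly f p) n = f (coeff p n)"
  using module_map_on_0[OF assms] by (simp add: coeff_map_poly)

lemma map_poly_module_map_add:
  assumes "subspace V" "module_map_on scl V W f" "p \<in> polys_over V" "q \<in> polys_over V"
  shows "map_poly f (p + q) = map_poly f p + map_poly f q"
  using assms(3,4,2)
  by (intro poly_eqI)
    (simp add: coeff_map_poly_module_map[OF assms(1,2)] polys_over_def module_map_on_def)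

lemma conformal_isomorphic_refl: "conformal_isomorphic scl V lpV V lpV"
  unfolding conformal_isomorphic_def
proof (intro exI conjI)
  show "conformal_hom scl V lpV V lpV (\<lambda>x. x)"
    by (auto simp: conformal_hom_def module_map_on_def)
  show "bij_betw (\<lambda>x. x) V V" by (simp add: bij_betw_def)
qed

text \<open>
  The product of \<open>V\<close> has to stay in \<open>V\<close>, since the inverse of \<open>f\<close> can only be cancelled on
  coefficients that lie in \<open>V\<close>.  The product of \<open>W\<close> is then determined by transport along \<open>f\<close>.
\<close>

lemma conformal_isomorphic_sym:
  assumes V: "subspace V" and closed: "\<And>x y. x \<in> V \<Longrightarrow> y \<in> V \<Longrightarrow> lpV x y \<in> polys_over V"
    and iso: "conformal_isomorphic scl V lpV W lpW"
  shows "conformal_isomorphic scl W lpW V lpV"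
proof -
  obtain f where f: "module_map_on scl V W f" "bij_betw f V W"
    and prod: "\<And>x y. x \<in> V \<Longrightarrow> y \<in> V \<Longrightarrow> map_poly f (lpV x y) = lpW (f x) (f y)"
    using iso by (auto simp: conformal_isomorphic_def conformal_hom_def)
  define g where "g = inv_into V f"
  have gV: "g w \<in> V" and fg: "f (g w) = w" if "w \<in> W" for w
    using f(2) that unfolding g_def
    by (auto simp: bij_betw_def inv_into_into f_inv_into_f)
  have gf: "g (f v) = v" if "v \<in> V" for v
    using f(2) that unfolding g_def by (auto simp: bij_betw_def)
  have g0: "g 0 = 0"
    using gf[OF subspace_0[OF V]] module_map_on_0[OF V f(1)] by simp
  have "module_map_on scl W V g"
    unfolding module_map_on_def
  proof (intro conjI ballI allI)
    show "g \<in> W \<rightarrow> V" using gV by auto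
    show "g (x + y) = g x + g y" if "x \<in> W" "y \<in> W" for x y
    proof -
      have "f (g x + g y) = x + y"
        using f(1) gV fg that unfolding module_map_on_def by metis
      then show ?thesis using gf subspace_add[OF V] gV that by metis
    qed
    show "g (scl p x) = scl p (g x)" if "x \<in> W" for p x
    proof -
      have "f (scl p (g x)) = scl p x"
        using f(1) gV fg that unfolding module_map_on_def by metis
      then show ?thesis using gf subspace_scale[OF V] gV that by metis
    qed
  qed
  moreover have "map_poly g (lpW x y) = lpV (g x) (g y)" if "x \<in> W" "y \<in> W" for x y
  proof -
    have "lpW x y = map_poly f (lpV (g x) (g y))"
      using prod[of "g x" "g y"] gV fg that by simp
    moreover have "coeff (lpV (g x) (g y)) n \<in> V" for n
      using closed[OF gV gV] that by (auto simp: polys_over_def)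
    ultimately show ?thesis
      by (intro poly_eqI)
        (simp add: coeff_map_poly g0 module_map_on_0[OF V f(1)] gf)
  qed
  moreover have "bij_betw g W V"
    unfolding g_def by (rule bij_betw_inv_into[OF f(2)])
  ultimately show ?thesis
    by (auto simp: conformal_isomorphic_def conformal_hom_def)
qed

lemma conformal_isomorphic_trans:
  assumes U: "subspace U" and V: "subspace V"
    and iso1: "conformal_isomorphic scl U lpU V lpV"
    and iso2: "conformal_isomorphic scl V lpV W lpW"
  shows "conformal_isomorphic scl U lpU W lpW"
proof -
  obtain f where f: "module_map_on scl U V f" "bij_betw f U V"
    and fprod: "\<And>x y. x \<in> U \<Longrightarrow> y \<in> U \<Longrightarrow> map_poly f (lpU x y) = lpV (f x) (f y)"
    using iso1 by (auto simp: conformal_isomorphic_def conformal_hom_def)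
  obtain g where g: "module_map_on scl V W g" "bij_betw g V W"
    and gprod: "\<And>x y. x \<in> V \<Longrightarrow> y \<in> V \<Longrightarrow> map_poly g (lpV x y) = lpW (g x) (g y)"
    using iso2 by (auto simp: conformal_isomorphic_def conformal_hom_def)
  have fV: "f x \<in> V" if "x \<in> U" for x
    using f(1) that by (auto simp: module_map_on_def)
  have "module_map_on scl U W (g \<circ> f)"
    using f(1) g(1) unfolding module_map_on_def by (auto simp: Pi_iff)
  moreover have "map_poly (g \<circ> f) (lpU x y) = lpW ((g \<circ> f) x) ((g \<circ> f) y)"
    if "x \<in> U" "y \<in> U" for x y
  proof -
    have "map_poly (g \<circ> f) (lpU x y) = map_poly g (map_poly f (lpU x y))"
      using module_map_on_0[OF U f(1)] module_map_on_0[OF V g(1)]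
      by (simp add: map_poly_map_poly)
    then show ?thesis using fprod gprod fV that by simp
  qed
  moreover have "bij_betw (g \<circ> f) U W"
    using bij_betw_trans[OF f(2) g(2)] .
  ultimately show ?thesis
    unfolding conformal_isomorphic_def conformal_hom_def by blast
qed

end

sublocale assoc_conformal_algebra \<subseteq> differential_module scl
  by unfold_locales

section \<open>Deformation maps and their graphs\<close>

locale factorized_conformal_algebra = assoc_conformal_algebra scl E lp
  for scl :: "complex poly \<Rightarrow> 'e::ab_group_add \<Rightarrow> 'e" and E lp +
  fixes A Q :: "'e set" and lhd rhd lhp rhp :: "'e \<Rightarrow> 'e \<Rightarrow> 'e poly"
  assumes subalgebra_A: "subalgebra scl E lp A"
    and complement_Q: "Q \<in> complements scl E lp A"
    and matched_pair: "associated_matched_pair lp A Q lhd rhd lhp rhp"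
begin

abbreviation "DM \<equiv> deformation_maps scl lp Q A lhd rhd lhp rhp"
abbreviation "deform \<equiv> deformed_product lp lhd rhp"
abbreviation "DM_equiv \<equiv> deformation_equiv scl lp Q A lhd rhd lhp rhp"

definition deformation_graph :: "('e \<Rightarrow> 'e) \<Rightarrow> 'e set"
  where "deformation_graph \<phi> = (\<lambda>x. \<phi> x + x) ` Q"

text \<open>
  The \<open>A\<close>-part of the product of two points of the graph of \<open>\<phi>\<close>, by \<open>product_of_graph_elements\<close>
  below; \<open>deform \<phi> x y\<close> is the \<open>Q\<close>-part.
\<close>

definition A_component :: "('e \<Rightarrow> 'e) \<Rightarrow> 'e \<Rightarrow> 'e \<Rightarrow> 'e poly"
  where "A_component \<phi> x y = lp (\<phi> x) (\<phi> y) + lhp (\<phi> x) y + rhd x (\<phi> y)"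

lemma A_submodule: "subspace A" and A_subset: "A \<subseteq> E"
  and A_closed: "a \<in> A \<Longrightarrow> b \<in> A \<Longrightarrow> lp a b \<in> polys_over A"
  using subalgebra_A by (auto simp: subalgebra_def)

lemma complementD:
  assumes "C \<in> complements scl E lp A"
  shows "subspace C" "C \<subseteq> E" "A \<inter> C = {0}" "E = {a + x | a x. a \<in> A \<and> x \<in> C}"
    and "\<And>x y. x \<in> C \<Longrightarrow> y \<in> C \<Longrightarrow> lp x y \<in> polys_over C"
  using assms by (auto simp: complements_def subalgebra_def)

lemmas Q_submodule = complementD(1)[OF complement_Q]
  and Q_subset = complementD(2)[OF complement_Q]
  and A_Int_Q = complementD(3)[OF complement_Q]
  and E_decomposition = complementD(4)[OF complement_Q]
  and Q_closed = complementD(5)[OF complement_Q]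

lemma actions:
  assumes "x \<in> Q" "a \<in> A"
  shows "rhd x a \<in> polys_over A" "lhd x a \<in> polys_over Q" "lp x a = rhd x a + lhd x a"
    and "lhp a x \<in> polys_over A" "rhp a x \<in> polys_over Q" "lp a x = lhp a x + rhp a x"
  using matched_pair assms by (auto simp: associated_matched_pair_def)

lemma deform_closed:
  assumes "\<phi> \<in> Q \<rightarrow> A" "x \<in> Q" "y \<in> Q"
  shows "deform \<phi> x y \<in> polys_over Q"
proof -
  have "\<phi> x \<in> A" "\<phi> y \<in> A" using assms by auto
  then show ?thesis
    unfolding deformed_product_def
    using assms by (intro polys_over_add Q_submodule Q_closed actions)
qed

lemma A_component_closed:
  assumes "\<phi> \<in> Q \<rightarrow> A" "x \<in> Q" "y \<in> Q"
  shows "A_component \<phi> x y \<in> polys_over A"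
proof -
  have "\<phi> x \<in> A" "\<phi> y \<in> A" using assms by auto
  then show ?thesis
    unfolding A_component_def
    using assms by (intro polys_over_add A_submodule A_closed actions)
qed

lemma product_of_graph_elements:
  assumes "\<phi> \<in> Q \<rightarrow> A" "x \<in> Q" "y \<in> Q"
  shows "lp (\<phi> x + x) (\<phi> y + y) = A_component \<phi> x y + deform \<phi> x y"
proof -
  have A: "\<phi> x \<in> A" "\<phi> y \<in> A" using assms by auto
  then have E: "\<phi> x \<in> E" "\<phi> y \<in> E" "x \<in> E" "y \<in> E"
    using A_subset Q_subset assms by auto
  have "lp (\<phi> x + x) (\<phi> y + y) = lp (\<phi> x) (\<phi> y) + lp (\<phi> x) y + (lp x (\<phi> y) + lp x y)"
    using E by (simp add: add_left add_right subspace_add[OF carrier])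
  then show ?thesis
    using A assms by (simp add: actions A_component_def deformed_product_def algebra_simps)
qed

text \<open>
  By additivity, the terms of the deformation equation in which \<open>\<phi>\<close> is applied to a polynomial
  over \<open>Q\<close> combine to \<open>\<phi>\<close> of the deformed product.  In the form obtained, the equation says that
  the product of two points of the graph has its coefficients in the graph again.
\<close>

lemma deformation_maps_iff:
  "\<phi> \<in> DM \<longleftrightarrow> \<phi> \<in> extensional Q \<and> module_map_on scl Q A \<phi> \<and>
    (\<forall>x\<in>Q. \<forall>y\<in>Q. map_poly \<phi> (deform \<phi> x y) = A_component \<phi> x y)"
proof (cases "module_map_on scl Q A \<phi>")
  case True
  have "map_poly \<phi> (lp x y) - lp (\<phi> x) (\<phi> y) =
        lhp (\<phi> x) y + rhd x (\<phi> y) - map_poly \<phi> (rhp (\<phi> x) y) - map_poly \<phi> (lhd x (\<phi> y))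
      \<longleftrightarrow> map_poly \<phi> (deform \<phi> x y) = A_component \<phi> x y" if "x \<in> Q" "y \<in> Q" for x y
  proof -
    have A: "\<phi> x \<in> A" "\<phi> y \<in> A" using True that by (auto simp: module_map_on_def)
    have "map_poly \<phi> (deform \<phi> x y) =
        map_poly \<phi> (lp x y) + map_poly \<phi> (lhd x (\<phi> y)) + map_poly \<phi> (rhp (\<phi> x) y)"
      unfolding deformed_product_def using A that
      by (simp add: map_poly_module_map_add[OF Q_submodule True] polys_over_add[OF Q_submodule]
          Q_closed actions)
    then show ?thesis
      by (auto simp: A_component_def algebra_simps)
  qed
  then show ?thesis using True by (auto simp: deformation_maps_def)
qed (simp add: deformation_maps_def)

lemma deformation_mapD:
  assumes "\<phi> \<in> DM"
  shows "module_map_on scl Q A \<phi>" "\<phi> \<in> Q \<rightarrow> A"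
    and "\<And>x y. x \<in> Q \<Longrightarrow> y \<in> Q \<Longrightarrow> map_poly \<phi> (deform \<phi> x y) = A_component \<phi> x y"
  using assms by (auto simp: deformation_maps_iff module_map_on_def)

text \<open>
  The equation in the definition of \<open>\<equiv>\<close> is the homomorphism equation for \<open>\<alpha>\<close> between the deformed
  algebras, with the undeformed products collected on the left.
\<close>

lemma deformation_equiv_iff:
  "(\<phi>, \<psi>) \<in> DM_equiv \<longleftrightarrow>
    \<phi> \<in> DM \<and> \<psi> \<in> DM \<and> conformal_isomorphic scl Q (deform \<phi>) Q (deform \<psi>)"
proof (cases "\<phi> \<in> DM \<and> \<psi> \<in> DM")
  case True
  have "map_poly \<alpha> (lp x y) - lp (\<alpha> x) (\<alpha> y) =
          lhd (\<alpha> x) (\<psi> (\<alpha> y)) - map_poly \<alpha> (lhd x (\<phi> y)) +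
          rhp (\<psi> (\<alpha> x)) (\<alpha> y) - map_poly \<alpha> (rhp (\<phi> x) y)
      \<longleftrightarrow> map_poly \<alpha> (deform \<phi> x y) = deform \<psi> (\<alpha> x) (\<alpha> y)"
    if \<alpha>: "module_map_on scl Q Q \<alpha>" and "x \<in> Q" "y \<in> Q" for \<alpha> x y
  proof -
    have A: "\<phi> x \<in> A" "\<phi> y \<in> A" using True that deformation_mapD(2) by auto
    have "map_poly \<alpha> (deform \<phi> x y) =
        map_poly \<alpha> (lp x y) + map_poly \<alpha> (lhd x (\<phi> y)) + map_poly \<alpha> (rhp (\<phi> x) y)"
      unfolding deformed_product_def using A that
      by (simp add: map_poly_module_map_add[OF Q_submodule \<alpha>] polys_over_add[OF Q_submodule]
          Q_closed actions)
    then show ?thesis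
      by (auto simp: deformed_product_def algebra_simps)
  qed
  then show ?thesis
    using True
    unfolding deformation_equiv_def conformal_isomorphic_def conformal_hom_def by blast
qed (auto simp: deformation_equiv_def)

text \<open>
  The parametrization \<open>x \<mapsto> \<phi> x + x\<close> is injective since its \<open>Q\<close>-part is \<open>x\<close>, and it respects
  products by \<open>product_of_graph_elements\<close> and the deformation equation.
\<close>

lemma deformed_iso_graph:
  assumes \<phi>: "\<phi> \<in> DM"
  shows "conformal_isomorphic scl Q (deform \<phi>) (deformation_graph \<phi>) lp"
proof -
  note D = deformation_mapD[OF \<phi>]
  let ?g = "\<lambda>x. \<phi> x + x"
  have "module_map_on scl Q (deformation_graph \<phi>) ?g"
    using D(1) by (auto simp: module_map_on_def deformation_graph_def algebra_simps scale_right_distrib)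
  moreover have "map_poly ?g (deform \<phi> x y) = lp (?g x) (?g y)" if "x \<in> Q" "y \<in> Q" for x y
  proof -
    have "map_poly ?g (deform \<phi> x y) = map_poly \<phi> (deform \<phi> x y) + deform \<phi> x y"
      using module_map_on_0[OF Q_submodule D(1)] by (intro poly_eqI) (simp add: coeff_map_poly)
    then show ?thesis
      using D(3) product_of_graph_elements[OF D(2)] that by simp
  qed
  moreover have "bij_betw ?g Q (deformation_graph \<phi>)"
    unfolding bij_betw_def
  proof
    show "inj_on ?g Q"
    proof
      fix x y assume xy: "x \<in> Q" "y \<in> Q" "\<phi> x + x = \<phi> y + y"
      have "\<phi> y - \<phi> x = x - y" using xy(3) by (simp add: algebra_simps)
      moreover have "\<phi> y - \<phi> x \<in> A" "x - y \<in> Q"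
        using xy D(2) A_submodule Q_submodule by (auto intro!: subspace_diff)
      ultimately have "x - y \<in> A \<inter> Q" by simp
      then show "x = y" using A_Int_Q by simp
    qed
    show "?g ` Q = deformation_graph \<phi>" by (simp add: deformation_graph_def)
  qed
  ultimately show ?thesis
    unfolding conformal_isomorphic_def conformal_hom_def by blast
qed

text \<open>
  The identity \<open>a + x = (a - \<phi> x) + (\<phi> x + x)\<close> turns the decomposition along \<open>Q\<close> into one along
  the graph, while the deformation equation makes the graph a subalgebra.
\<close>

lemma graph_is_complement:
  assumes \<phi>: "\<phi> \<in> DM"
  shows "deformation_graph \<phi> \<in> complements scl E lp A"
proof -
  note D = deformation_mapD[OF \<phi>]
  let ?G = "deformation_graph \<phi>"
  have add: "\<phi> (x + y) = \<phi> x + \<phi> y" and scale: "\<phi> (scl p x) = scl p (\<phi> x)" and A: "\<phi> x \<in> A"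
    if "x \<in> Q" "y \<in> Q" for x y p
    using D(1) that by (auto simp: module_map_on_def)
  have GE: "?G \<subseteq> E"
    using D(2) A_subset Q_subset
    by (auto simp: deformation_graph_def intro!: subspace_add[OF carrier])
  have sub: "subspace ?G"
  proof (rule subspaceI)
    show "0 \<in> ?G"
      using subspace_0[OF Q_submodule] module_map_on_0[OF Q_submodule D(1)]
      by (auto simp: deformation_graph_def image_iff intro!: bexI[of _ 0])
    show "u + v \<in> ?G" if uv: "u \<in> ?G" "v \<in> ?G" for u v
    proof -
      obtain x y where "x \<in> Q" "y \<in> Q" "u = \<phi> x + x" "v = \<phi> y + y"
        using uv by (auto simp: deformation_graph_def)
      then show ?thesis
        using add subspace_add[OF Q_submodule]
        by (auto simp: deformation_graph_def image_iff algebra_simps intro!: bexI[of _ "x + y"])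
    qed
    show "scl p u \<in> ?G" if u: "u \<in> ?G" for p u
    proof -
      obtain x where "x \<in> Q" "u = \<phi> x + x" using u by (auto simp: deformation_graph_def)
      then show ?thesis
        using scale subspace_scale[OF Q_submodule]
        by (auto simp: deformation_graph_def image_iff scale_right_distrib
            intro!: bexI[of _ "scl p x"])
    qed
  qed
  have closed: "lp u v \<in> polys_over ?G" if uv: "u \<in> ?G" "v \<in> ?G" for u v
  proof -
    obtain x y where xy: "x \<in> Q" "y \<in> Q" "u = \<phi> x + x" "v = \<phi> y + y"
      using uv by (auto simp: deformation_graph_def)
    have "coeff (lp u v) n = \<phi> (coeff (deform \<phi> x y) n) + coeff (deform \<phi> x y) n" for n
      using product_of_graph_elements[OF D(2) xy(1,2)] D(3)[OF xy(1,2)] xy(3,4)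
      by (metis coeff_add coeff_map_poly_module_map[OF Q_submodule D(1)])
    then show ?thesis
      using deform_closed[OF D(2) xy(1,2)] by (auto simp: polys_over_def deformation_graph_def)
  qed
  have "A \<inter> ?G = {0}"
  proof -
    have "u = 0" if u: "u \<in> A" "u \<in> ?G" for u
    proof -
      obtain x where x: "x \<in> Q" "u = \<phi> x + x" using u by (auto simp: deformation_graph_def)
      have "u - \<phi> x \<in> A" using u(1) A[OF x(1) x(1)] by (rule subspace_diff[OF A_submodule])
      then have "x = 0" using x A_Int_Q by auto
      then show ?thesis using x module_map_on_0[OF Q_submodule D(1)] by simp
    qed
    then show ?thesis using subspace_0[OF A_submodule] subspace_0[OF sub] by auto
  qed
  moreover have "E = {a + u | a u. a \<in> A \<and> u \<in> ?G}"
  proof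
    show "E \<subseteq> {a + u | a u. a \<in> A \<and> u \<in> ?G}"
    proof
      fix e assume "e \<in> E"
      then obtain a x where ax: "a \<in> A" "x \<in> Q" "e = a + x" using E_decomposition by auto
      have "e = (a - \<phi> x) + (\<phi> x + x)" using ax by simp
      moreover have "a - \<phi> x \<in> A" using ax A by (auto intro: subspace_diff[OF A_submodule])
      moreover have "\<phi> x + x \<in> ?G" using ax by (auto simp: deformation_graph_def)
      ultimately show "e \<in> {a + u | a u. a \<in> A \<and> u \<in> ?G}" by blast
    qed
    show "{a + u | a u. a \<in> A \<and> u \<in> ?G} \<subseteq> E"
      using A_subset GE by (auto intro!: subspace_add[OF carrier])
  qed
  ultimately show ?thesis
    using GE sub closed by (auto simp: complements_def subalgebra_def)
qed

text \<open>
  Writing \<open>x \<in> Q\<close> along \<open>E = A \<oplus> C\<close> as \<open>x = a + c\<close> puts \<open>-a + x\<close> in \<open>C\<close>, so \<open>\<phi> x = -a\<close> is the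
  only choice.  This uniqueness makes \<open>\<phi>\<close> linear, and applied to the coefficients of a product it
  gives the deformation equation.
\<close>

lemma complement_is_graph:
  assumes C: "C \<in> complements scl E lp A"
  obtains \<phi> where "\<phi> \<in> DM" "C = deformation_graph \<phi>"
proof -
  note Cs = complementD[OF C]
  define \<phi> where "\<phi> = restrict (\<lambda>x. THE a. a \<in> A \<and> a + x \<in> C) Q"
  have unique: "a = b" if "a \<in> A" "a + x \<in> C" "b \<in> A" "b + x \<in> C" for a b x
  proof -
    have "a - b \<in> A" using that subspace_diff[OF A_submodule] by blast
    moreover have "a - b \<in> C" using subspace_diff[OF Cs(1) that(2,4)] by simp
    ultimately have "a - b \<in> A \<inter> C" by simp
    then show ?thesis using Cs(3) by simp
  qed
  have exists: "\<exists>a. a \<in> A \<and> a + x \<in> C" if x: "x \<in> Q" for x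
  proof -
    obtain a c where ac: "a \<in> A" "c \<in> C" "x = a + c" using x Q_subset Cs(4) by blast
    then have "- a \<in> A \<and> - a + x \<in> C" using subspace_neg[OF A_submodule] by simp
    then show ?thesis by blast
  qed
  have \<phi>: "\<phi> x \<in> A \<and> \<phi> x + x \<in> C" if "x \<in> Q" for x
  proof -
    have "\<exists>!a. a \<in> A \<and> a + x \<in> C" using exists[OF that] unique by blast
    from theI'[OF this] show ?thesis using that by (simp add: \<phi>_def)
  qed
  have \<phi>_eqI: "\<phi> x = a" if "x \<in> Q" "a \<in> A" "a + x \<in> C" for x a
    using \<phi> unique that by blast
  have \<phi>A: "\<phi> \<in> Q \<rightarrow> A" using \<phi> by auto
  have mod: "module_map_on scl Q A \<phi>"
    unfolding module_map_on_def
  proof (intro conjI ballI allI)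
    show "\<phi> \<in> Q \<rightarrow> A" by (rule \<phi>A)
    show "\<phi> (x + y) = \<phi> x + \<phi> y" if "x \<in> Q" "y \<in> Q" for x y
    proof (rule \<phi>_eqI)
      show "\<phi> x + \<phi> y + (x + y) \<in> C"
        using subspace_add[OF Cs(1), of "\<phi> x + x" "\<phi> y + y"] \<phi> that by (simp add: algebra_simps)
    qed (use \<phi> that in \<open>auto intro: subspace_add[OF Q_submodule] subspace_add[OF A_submodule]\<close>)
    show "\<phi> (scl p x) = scl p (\<phi> x)" if "x \<in> Q" for p x
    proof (rule \<phi>_eqI)
      show "scl p (\<phi> x) + scl p x \<in> C"
        using subspace_scale[OF Cs(1), of "\<phi> x + x" p] \<phi> that by (simp add: scale_right_distrib)
    qed (use \<phi> that in \<open>auto intro: subspace_scale[OF Q_submodule] subspace_scale[OF A_submodule]\<close>)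
  qed
  have "map_poly \<phi> (deform \<phi> x y) = A_component \<phi> x y" if xy: "x \<in> Q" "y \<in> Q" for x y
  proof (rule poly_eqI)
    fix n
    have "coeff (A_component \<phi> x y) n + coeff (deform \<phi> x y) n \<in> C"
      using Cs(5)[of "\<phi> x + x" "\<phi> y + y"] \<phi> xy product_of_graph_elements[OF \<phi>A xy]
      by (simp add: polys_over_def)
    then have "\<phi> (coeff (deform \<phi> x y) n) = coeff (A_component \<phi> x y) n"
      using deform_closed[OF \<phi>A xy] A_component_closed[OF \<phi>A xy]
      by (intro \<phi>_eqI) (auto simp: polys_over_def)
    then show "coeff (map_poly \<phi> (deform \<phi> x y)) n = coeff (A_component \<phi> x y) n"
      by (simp add: coeff_map_poly_module_map[OF Q_submodule mod])
  qed
  then have "\<phi> \<in> DM"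
    using mod by (auto simp: deformation_maps_iff \<phi>_def)
  moreover have "C = deformation_graph \<phi>"
  proof
    show "C \<subseteq> deformation_graph \<phi>"
    proof
      fix c assume c: "c \<in> C"
      then obtain a x where ax: "a \<in> A" "x \<in> Q" "c = a + x"
        using Cs(2) E_decomposition by blast
      then have "\<phi> x = a" using \<phi>_eqI c by blast
      then show "c \<in> deformation_graph \<phi>" using ax by (auto simp: deformation_graph_def)
    qed
    show "deformation_graph \<phi> \<subseteq> C" using \<phi> by (auto simp: deformation_graph_def)
  qed
  ultimately show ?thesis by (rule that)
qed

section \<open>The classification of complements\<close>

abbreviation "iso_complements \<phi> \<equiv>
  {C \<in> complements scl E lp A. conformal_isomorphic scl C lp Q (deform \<phi>)}"

lemma deformed_iso_sym:
  assumes "\<phi> \<in> DM" "conformal_isomorphic scl Q (deform \<phi>) W lpW"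
  shows "conformal_isomorphic scl W lpW Q (deform \<phi>)"
  using assms deform_closed[OF deformation_mapD(2)[OF assms(1)]]
  by (blast intro: conformal_isomorphic_sym[OF Q_submodule])

lemma equiv_deformation_equiv: "equiv DM DM_equiv"
proof (rule equivI)
  show "DM_equiv \<subseteq> DM \<times> DM" by (auto simp: deformation_equiv_iff)
  show "refl_on DM DM_equiv"
    by (auto simp: refl_on_def deformation_equiv_iff conformal_isomorphic_refl)
  show "sym DM_equiv"
    by (auto simp: sym_def deformation_equiv_iff intro: deformed_iso_sym)
  show "trans DM_equiv"
    by (auto simp: trans_def deformation_equiv_iff
        intro: conformal_isomorphic_trans[OF Q_submodule Q_submodule])
qed

text \<open>
  The complements isomorphic to \<open>Q\<^sub>\<phi>\<close> form a full isomorphism class as soon as there is one of them;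
  the graph of \<open>\<phi>\<close> always is one.
\<close>

lemma iso_complements_eq_class:
  assumes \<phi>: "\<phi> \<in> DM" and C: "C \<in> iso_complements \<phi>"
  shows "iso_complements \<phi> = complement_iso scl E lp A `` {C}"
proof -
  have C': "C \<in> complements scl E lp A" "conformal_isomorphic scl C lp Q (deform \<phi>)"
    using C by auto
  note CD = complementD[OF C'(1)]
  have Q_to_C: "conformal_isomorphic scl Q (deform \<phi>) C lp"
    by (rule conformal_isomorphic_sym[OF CD(1,5) C'(2)])
  have "conformal_isomorphic scl C' lp Q (deform \<phi>) \<longleftrightarrow> conformal_isomorphic scl C lp C' lp"
    if "C' \<in> complements scl E lp A" for C'
  proof -
    note CD' = complementD[OF that]
    show ?thesis
    proof
      assume C'_to_Q: "conformal_isomorphic scl C' lp Q (deform \<phi>)"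
      have "conformal_isomorphic scl Q (deform \<phi>) C' lp"
        by (rule conformal_isomorphic_sym[OF CD'(1,5) C'_to_Q])
      then show "conformal_isomorphic scl C lp C' lp"
        by (rule conformal_isomorphic_trans[OF CD(1) Q_submodule C'(2)])
    next
      assume "conformal_isomorphic scl C lp C' lp"
      with Q_to_C have "conformal_isomorphic scl Q (deform \<phi>) C' lp"
        by (rule conformal_isomorphic_trans[OF Q_submodule CD(1)])
      then show "conformal_isomorphic scl C' lp Q (deform \<phi>)"
        by (rule deformed_iso_sym[OF \<phi>])
    qed
  qed
  then show ?thesis using C'(1) by (auto simp: complement_iso_def)
qed

lemma graph_in_iso_complements:
  assumes "\<phi> \<in> DM"
  shows "deformation_graph \<phi> \<in> iso_complements \<phi>"
  using graph_is_complement[OF assms] deformed_iso_sym[OF assms deformed_iso_graph[OF assms]]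
  by simp

lemma iso_complements_eq_iff:
  assumes \<phi>: "\<phi> \<in> DM" and \<psi>: "\<psi> \<in> DM"
  shows "iso_complements \<phi> = iso_complements \<psi> \<longleftrightarrow> (\<phi>, \<psi>) \<in> DM_equiv"
proof
  assume "iso_complements \<phi> = iso_complements \<psi>"
  then have "conformal_isomorphic scl (deformation_graph \<phi>) lp Q (deform \<psi>)"
    using graph_in_iso_complements[OF \<phi>] by auto
  then show "(\<phi>, \<psi>) \<in> DM_equiv"
    using conformal_isomorphic_trans[OF Q_submodule complementD(1)[OF graph_is_complement[OF \<phi>]]
        deformed_iso_graph[OF \<phi>]] \<phi> \<psi>
    by (simp add: deformation_equiv_iff)
next
  assume eq: "(\<phi>, \<psi>) \<in> DM_equiv"
  have sub: "iso_complements \<phi>' \<subseteq> iso_complements \<psi>'" if "(\<phi>', \<psi>') \<in> DM_equiv" for \<phi>' \<psi>'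
    using that
    by (auto simp: deformation_equiv_iff
        intro: conformal_isomorphic_trans[OF complementD(1) Q_submodule])
  have "(\<psi>, \<phi>) \<in> DM_equiv"
    using eq equiv_deformation_equiv by (meson equivE symD)
  then show "iso_complements \<phi> = iso_complements \<psi>"
    using sub eq by blast
qed

lemma bij_betw_HA2_complement_classes:
  "\<exists>F. (\<forall>\<phi>\<in>DM. F (DM_equiv `` {\<phi>}) = iso_complements \<phi>) \<and>
    bij_betw F (HA2 scl lp Q A lhd rhd lhp rhp) (complement_classes scl E lp A)"
proof (intro exI conjI ballI)
  \<comment> \<open>All terms of this union agree, since equivalent deformation maps have isomorphic deformed
    algebras; the union avoids a choice of representative.\<close>
  define F where "F X = (\<Union>\<phi>\<in>X. iso_complements \<phi>)" for X
  show F: "F (DM_equiv `` {\<phi>}) = iso_complements \<phi>" if \<phi>: "\<phi> \<in> DM" for \<phi>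
  proof -
    have "\<phi> \<in> DM_equiv `` {\<phi>}"
      using equiv_class_self[OF equiv_deformation_equiv \<phi>] .
    moreover have "iso_complements \<psi> = iso_complements \<phi>" if "\<psi> \<in> DM_equiv `` {\<phi>}" for \<psi>
      using that iso_complements_eq_iff[of \<phi> \<psi>] by (auto simp: deformation_equiv_iff)
    ultimately show ?thesis unfolding F_def by blast
  qed
  show "bij_betw F (HA2 scl lp Q A lhd rhd lhp rhp) (complement_classes scl E lp A)"
    unfolding bij_betw_def
  proof
    show "inj_on F (HA2 scl lp Q A lhd rhd lhp rhp)"
    proof
      fix X Y assume XY: "X \<in> HA2 scl lp Q A lhd rhd lhp rhp" "Y \<in> HA2 scl lp Q A lhd rhd lhp rhp"
        "F X = F Y"
      then obtain \<phi> \<psi> where reps: "\<phi> \<in> DM" "X = DM_equiv `` {\<phi>}" "\<psi> \<in> DM" "Y = DM_equiv `` {\<psi>}"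
        by (auto simp: HA2_def elim!: quotientE)
      then have "(\<phi>, \<psi>) \<in> DM_equiv"
        using XY(3) F iso_complements_eq_iff by simp
      then show "X = Y"
        using reps equiv_class_eq[OF equiv_deformation_equiv] by simp
    qed
    show "F ` HA2 scl lp Q A lhd rhd lhp rhp = complement_classes scl E lp A"
    proof
      show "F ` HA2 scl lp Q A lhd rhd lhp rhp \<subseteq> complement_classes scl E lp A"
      proof (clarsimp simp: HA2_def elim!: quotientE)
        fix \<phi> assume \<phi>: "\<phi> \<in> DM"
        then show "F (DM_equiv `` {\<phi>}) \<in> complement_classes scl E lp A"
          using F[OF \<phi>] iso_complements_eq_class[OF \<phi> graph_in_iso_complements[OF \<phi>]]
            graph_is_complement[OF \<phi>]
          by (simp add: complement_classes_def quotientI)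
      qed
      show "complement_classes scl E lp A \<subseteq> F ` HA2 scl lp Q A lhd rhd lhp rhp"
      proof
        fix K assume "K \<in> complement_classes scl E lp A"
        then obtain C where C: "C \<in> complements scl E lp A" "K = complement_iso scl E lp A `` {C}"
          by (auto simp: complement_classes_def elim!: quotientE)
        obtain \<phi> where \<phi>: "\<phi> \<in> DM" "C = deformation_graph \<phi>"
          using complement_is_graph[OF C(1)] .
        then have "K = F (DM_equiv `` {\<phi>})"
          using F iso_complements_eq_class[OF \<phi>(1) graph_in_iso_complements[OF \<phi>(1)]] C(2) by simp
        then show "K \<in> F ` HA2 scl lp Q A lhd rhd lhp rhp"
          using \<phi>(1) by (auto simp: HA2_def intro: quotientI)
      qed
    qed
  qed
qed

end

theorem theorem4p9:
  fixes scl :: "complex poly \<Rightarrow> 'e::ab_group_add \<Rightarrow> 'e"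
    and lp lhd rhd lhp rhp :: "'e \<Rightarrow> 'e \<Rightarrow> 'e poly"
    and E A Q :: "'e set"
  assumes "assoc_conformal_algebra scl E lp"
    and "subalgebra scl E lp A"
    and "Q \<in> complements scl E lp A"
    and "associated_matched_pair lp A Q lhd rhd lhp rhp"
  shows "equiv (deformation_maps scl lp Q A lhd rhd lhp rhp)
           (deformation_equiv scl lp Q A lhd rhd lhp rhp) \<and>
         (\<exists>F. (\<forall>\<phi>\<in>deformation_maps scl lp Q A lhd rhd lhp rhp.
                 F (deformation_equiv scl lp Q A lhd rhd lhp rhp `` {\<phi>}) =
                 {C \<in> complements scl E lp A.
                    conformal_isomorphic scl C lp Q (deformed_product lp lhd rhp \<phi>)}) \<and>
              bij_betw F (HA2 scl lp Q A lhd rhd lhp rhp) (complement_classes scl E lp A))"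
proof -
  interpret assoc_conformal_algebra scl E lp by fact
  interpret factorized_conformal_algebra scl E lp A Q lhd rhd lhp rhp
    by (unfold_locales; fact)
  show ?thesis
    using equiv_deformation_equiv bij_betw_HA2_complement_classes by simp
qed

end
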